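(* Let $\mathcal{L} = D_xD_y + aD_x + bD_y + c \in K[D]$. Then every Darboux transformation of $\mathcal{L}$ generated by an operator $\mathcal{M} = D_x + qD_y + r \in K[D]$, $q \neq 0$, is described by Darboux Wronskian formulas. That is, if $\mathcal{M} = D_x + qD_y + r$ with $q,r\in K$, $q\ne 0$, and there exist $\mathcal{N}, \mathcal{L}_1 \in K[D]$ with $\mathrm{Sym}(\mathcal{L}_1)=\mathrm{Sym}(\mathcal{L})$ and $\mathcal{N}\circ\mathcal{L} = \mathcal{L}_1\circ\mathcal{M}$, then there exist two linearly independent solutions $\psi_1,\psi_2 \in K$ of $\mathcal{L}\psi = 0$ such that $d := -\psi_1\psi_{2y} + \psi_2\psi_{1y} \neq 0$ and $$\mathcal{M} = D_x + \frac{\alpha}{d}\, D_y + \frac{\beta}{d}, \qquad \alpha = \psi_1\psi_{2x} - \psi_2\psi_{1x}, \quad \beta = -\psi_{2x}\psi_{1y} + \psi_{2y}\psi_{1x}.$$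
   Context: $K$ is a differential field of characteristic zero with commuting derivations $\partial_x,\partial_y$; it is assumed to be differentially closed (or, at least, to contain the solutions of all the partial differential equations with coefficients in $K$ that are needed). Subscripts $x,y$ on elements of $K$ denote derivatives. $K[D]=K[D_x,D_y]$ is the ring of linear partial differential operators over $K$ ($D_x, D_y$ corresponding to $\partial_x,\partial_y$), and $a,b,c,q,r\in K$ are not required to be constants. The symbol of $\sum_{i+j\le d}a_{ij}D_x^iD_y^j$ of order $d$ is the polynomial $\sum_{i+j=d}a_{ij}X^iY^j$. A Darboux transformation of $\mathcal{L}$ generated by $\mathcal{M}$ (for the pair $(\mathcal{L},\mathcal{M})$) consists of operators $\mathcal{N},\mathcal{L}_1\in K[D]$ with $\mathrm{Sym}(\mathcal{L}_1)=\mathrm{Sym}(\mathcal{L})$ and $\mathcal{N}\circ\mathcal{L}=\mathcal{L}_1\circ\mathcal{M}$. Linear independence is over the field of constants of $K$. The Darboux Wronskian formula for two solutions $\psi_1,\psi_2$ of $\mathcal{L}\psi=0$ is $$\mathcal{M}(\psi)= \frac1d\begin{vmatrix}\psi & \psi_x & \psi_y\\ \psi_1&\psi_{1x}&\psi_{1y}\\ \psi_2&\psi_{2x}&\psi_{2y}\end{vmatrix},$$ normalized (by dividing by $d$) so that the coefficient of $D_x$ equals $1$; this is exactly the operator $D_x+\frac{\alpha}{d}D_y+\frac{\beta}{d}$. *)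

theory Defs
  imports
    "HOL-Algebra.Algebraic_Closure_Type"
    "HOL-Library.Poly_Mapping"
begin

section \<open>Differential fields\<close>

locale differential_field = field F for F (structure) +
  fixes dx dy :: "'a \<Rightarrow> 'a"
  assumes dx_closed: "u \<in> carrier F \<Longrightarrow> dx u \<in> carrier F"
    and dy_closed: "u \<in> carrier F \<Longrightarrow> dy u \<in> carrier F"
    and dx_add: "\<lbrakk>u \<in> carrier F; v \<in> carrier F\<rbrakk> \<Longrightarrow> dx (u \<oplus> v) = dx u \<oplus> dx v"
    and dy_add: "\<lbrakk>u \<in> carrier F; v \<in> carrier F\<rbrakk> \<Longrightarrow> dy (u \<oplus> v) = dy u \<oplus> dy v"
    and dx_mult: "\<lbrakk>u \<in> carrier F; v \<in> carrier F\<rbrakk> \<Longrightarrow> dx (u \<otimes> v) = (dx u \<otimes> v) \<oplus> (u \<otimes> dx v)"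
    and dy_mult: "\<lbrakk>u \<in> carrier F; v \<in> carrier F\<rbrakk> \<Longrightarrow> dy (u \<otimes> v) = (dy u \<otimes> v) \<oplus> (u \<otimes> dy v)"
    and dx_dy_commute: "u \<in> carrier F \<Longrightarrow> dx (dy u) = dy (dx u)"

text \<open>A field of characteristic zero with two commuting derivations, carried by a whole type.
  The base field is of this kind; the record version above is needed to quantify
  over its differential field extensions.\<close>

abbreviation type_differential_field ::
    "('k::field_char_0 \<Rightarrow> 'k) \<Rightarrow> ('k \<Rightarrow> 'k) \<Rightarrow> bool" where
  "type_differential_field \<equiv> differential_field ring_of_type_algebra"

lemma type_differential_field_iff:
  fixes dx dy :: "'k::field_char_0 \<Rightarrow> 'k"
  shows "type_differential_field dx dy \<longleftrightarrow>
    (\<forall>u v. dx (u + v) = dx u + dx v) \<and> (\<forall>u v. dy (u + v) = dy u + dy v) \<and>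
    (\<forall>u v. dx (u * v) = dx u * v + u * dx v) \<and> (\<forall>u v. dy (u * v) = dy u * v + u * dy v) \<and>
    (\<forall>u. dx (dy u) = dy (dx u))"
  unfolding differential_field_def differential_field_axioms_def
  using field_from_type_algebra by (auto simp: ring_of_type_algebra_def)

definition constants :: "('k::field \<Rightarrow> 'k) \<Rightarrow> ('k \<Rightarrow> 'k) \<Rightarrow> 'k set" where
  "constants dx dy = {c. dx c = 0 \<and> dy c = 0}"

definition lin_indep2 :: "('k::field \<Rightarrow> 'k) \<Rightarrow> ('k \<Rightarrow> 'k) \<Rightarrow> 'k \<Rightarrow> 'k \<Rightarrow> bool" where
  "lin_indep2 dx dy \<psi>1 \<psi>2 \<longleftrightarrow>
    (\<forall>c1 \<in> constants dx dy. \<forall>c2 \<in> constants dx dy. c1 * \<psi>1 + c2 * \<psi>2 = 0 \<longrightarrow> c1 = 0 \<and> c2 = 0)"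

section \<open>Differentially closed fields\<close>

text \<open>Expressions for differential polynomials over \<open>'k\<close> in the differential indeterminates
  \<open>Indet 0, Indet 1, \<dots>\<close>. Only finitely many indeterminates occur in any expression.\<close>

datatype 'k dpoly =
    Coef 'k
  | Indet nat
  | Plus "'k dpoly" "'k dpoly"
  | Times "'k dpoly" "'k dpoly"
  | DerivX "'k dpoly"
  | DerivY "'k dpoly"

primrec dpoly_eval ::
    "'f ring \<Rightarrow> ('f \<Rightarrow> 'f) \<Rightarrow> ('f \<Rightarrow> 'f) \<Rightarrow> ('k \<Rightarrow> 'f) \<Rightarrow> (nat \<Rightarrow> 'f) \<Rightarrow> 'k dpoly \<Rightarrow> 'f" where
  "dpoly_eval F dx dy \<iota> v (Coef k) = \<iota> k"
| "dpoly_eval F dx dy \<iota> v (Indet n) = v n"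
| "dpoly_eval F dx dy \<iota> v (Plus p q) = dpoly_eval F dx dy \<iota> v p \<oplus>\<^bsub>F\<^esub> dpoly_eval F dx dy \<iota> v q"
| "dpoly_eval F dx dy \<iota> v (Times p q) = dpoly_eval F dx dy \<iota> v p \<otimes>\<^bsub>F\<^esub> dpoly_eval F dx dy \<iota> v q"
| "dpoly_eval F dx dy \<iota> v (DerivX p) = dx (dpoly_eval F dx dy \<iota> v p)"
| "dpoly_eval F dx dy \<iota> v (DerivY p) = dy (dpoly_eval F dx dy \<iota> v p)"

definition dsystem_solution ::
    "'f ring \<Rightarrow> ('f \<Rightarrow> 'f) \<Rightarrow> ('f \<Rightarrow> 'f) \<Rightarrow> ('k \<Rightarrow> 'f) \<Rightarrow> 'k dpoly set \<Rightarrow> 'k dpoly set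
      \<Rightarrow> (nat \<Rightarrow> 'f) \<Rightarrow> bool" where
  "dsystem_solution F dx dy \<iota> E I v \<longleftrightarrow>
    range v \<subseteq> carrier F \<and>
    (\<forall>p\<in>E. dpoly_eval F dx dy \<iota> v p = \<zero>\<^bsub>F\<^esub>) \<and> (\<forall>p\<in>I. dpoly_eval F dx dy \<iota> v p \<noteq> \<zero>\<^bsub>F\<^esub>)"

text \<open>A ring homomorphism between fields is injective, so \<open>\<iota>\<close> is an embedding.\<close>

definition differential_extension ::
    "('k::field_char_0 \<Rightarrow> 'k) \<Rightarrow> ('k \<Rightarrow> 'k) \<Rightarrow> 'f ring \<Rightarrow> ('f \<Rightarrow> 'f) \<Rightarrow> ('f \<Rightarrow> 'f) \<Rightarrow> ('k \<Rightarrow> 'f) \<Rightarrow> bool" where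
  "differential_extension dx dy F ex ey \<iota> \<longleftrightarrow>
    differential_field F ex ey \<and> \<iota> \<in> ring_hom ring_of_type_algebra F \<and>
    (\<forall>u. \<iota> (dx u) = ex (\<iota> u)) \<and> (\<forall>u. \<iota> (dy u) = ey (\<iota> u))"

text \<open>Differentially closed: every finite system of differential polynomial equations and
  inequations over \<open>K\<close> that is solvable in some differential field extension of \<open>K\<close> is solvable
  in \<open>K\<close>. HOL cannot quantify over all types inside a formula, so extensions are taken with carrier
  a subset of \<open>nat \<Rightarrow> 'k\<close>. Nothing is lost: a solution of a finite system generates over \<open>K\<close>
  a differential field extension that is countably generated as a field, hence has the cardinality
  of the (infinite) field \<open>K\<close>, and so has an isomorphic copy with carrier in this type.\<close>

definition differentially_closed ::
    "('k::field_char_0 \<Rightarrow> 'k) \<Rightarrow> ('k \<Rightarrow> 'k) \<Rightarrow> bool" where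
  "differentially_closed dx dy \<longleftrightarrow>
    type_differential_field dx dy \<and>
    (\<forall>E I :: 'k dpoly set. finite E \<longrightarrow> finite I \<longrightarrow>
      (\<exists>(F :: (nat \<Rightarrow> 'k) ring) ex ey \<iota>. differential_extension dx dy F ex ey \<iota> \<and>
          (\<exists>v. dsystem_solution F ex ey \<iota> E I v)) \<longrightarrow>
      (\<exists>w. dsystem_solution ring_of_type_algebra dx dy id E I w))"

section \<open>Linear partial differential operators\<close>

text \<open>The operator \<open>\<Sum> a\<^sub>i\<^sub>j D\<^sub>x\<^sup>i D\<^sub>y\<^sup>j\<close> is the finitely supported family of its coefficients,
  with the (noncommutative) product given by \<open>dcomp\<close>.
  The same type represents the polynomials \<open>\<Sum> a\<^sub>i\<^sub>j X\<^sup>i Y\<^sup>j\<close> that occur as symbols.\<close>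

type_synonym 'k diffop = "nat \<times> nat \<Rightarrow>\<^sub>0 'k"

text \<open>\<open>dmon f i j\<close> stands for \<open>f D\<^sub>x\<^sup>i D\<^sub>y\<^sup>j\<close>.\<close>

definition dmon :: "'k::field \<Rightarrow> nat \<Rightarrow> nat \<Rightarrow> 'k diffop" where
  "dmon f i j = Poly_Mapping.single (i, j) f"

definition dapply :: "('k::field \<Rightarrow> 'k) \<Rightarrow> ('k \<Rightarrow> 'k) \<Rightarrow> 'k diffop \<Rightarrow> 'k \<Rightarrow> 'k" where
  "dapply dx dy P \<psi> =
    (\<Sum>(i, j)\<in>Poly_Mapping.keys P. Poly_Mapping.lookup P (i, j) * (dx ^^ i) ((dy ^^ j) \<psi>))"

text \<open>Composition, obtained from \<open>D\<^sub>x \<circ> f = f D\<^sub>x + f\<^sub>x\<close> and \<open>D\<^sub>y \<circ> f = f D\<^sub>y + f\<^sub>y\<close>,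
  i.e. from the Leibniz formula for \<open>D\<^sub>x\<^sup>i D\<^sub>y\<^sup>j \<circ> g\<close>.\<close>

definition dcomp_mon ::
    "('k::field \<Rightarrow> 'k) \<Rightarrow> ('k \<Rightarrow> 'k) \<Rightarrow> 'k \<Rightarrow> nat \<Rightarrow> nat \<Rightarrow> 'k \<Rightarrow> nat \<Rightarrow> nat \<Rightarrow> 'k diffop" where
  "dcomp_mon dx dy f i j g k l =
    (\<Sum>m\<le>i. \<Sum>n\<le>j. dmon (f * of_nat (i choose m) * of_nat (j choose n) * (dx ^^ m) ((dy ^^ n) g))
      (i - m + k) (j - n + l))"

definition dcomp ::
    "('k::field \<Rightarrow> 'k) \<Rightarrow> ('k \<Rightarrow> 'k) \<Rightarrow> 'k diffop \<Rightarrow> 'k diffop \<Rightarrow> 'k diffop" where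
  "dcomp dx dy P Q =
    (\<Sum>(i, j)\<in>Poly_Mapping.keys P. \<Sum>(k, l)\<in>Poly_Mapping.keys Q.
      dcomp_mon dx dy (Poly_Mapping.lookup P (i, j)) i j (Poly_Mapping.lookup Q (k, l)) k l)"

text \<open>The zero operator gets order \<open>0\<close> and symbol \<open>0\<close>.\<close>

definition dorder :: "'k::field diffop \<Rightarrow> nat" where
  "dorder P = Max (insert 0 ((\<lambda>(i, j). i + j) ` Poly_Mapping.keys P))"

definition dsymbol :: "'k::field diffop \<Rightarrow> (nat \<times> nat \<Rightarrow>\<^sub>0 'k)" where
  "dsymbol P = (\<Sum>(i, j) | (i, j) \<in> Poly_Mapping.keys P \<and> i + j = dorder P.
      Poly_Mapping.single (i, j) (Poly_Mapping.lookup P (i, j)))"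

definition darboux_transformation ::
    "('k::field \<Rightarrow> 'k) \<Rightarrow> ('k \<Rightarrow> 'k) \<Rightarrow> 'k diffop \<Rightarrow> 'k diffop \<Rightarrow> 'k diffop \<Rightarrow> 'k diffop \<Rightarrow> bool" where
  "darboux_transformation dx dy L M N L1 \<longleftrightarrow>
    dsymbol L1 = dsymbol L \<and> dcomp dx dy N L = dcomp dx dy L1 M"

lemma dapply_dmon [simp]: "dapply dx dy (dmon f i j) \<psi> = f * (dx ^^ i) ((dy ^^ j) \<psi>)"
  by (simp add: dapply_def dmon_def)

lemma dapply_superset:
  assumes "finite A" "Poly_Mapping.keys P \<subseteq> A"
  shows "dapply dx dy P \<psi> = (\<Sum>(i, j)\<in>A. Poly_Mapping.lookup P (i, j) * (dx ^^ i) ((dy ^^ j) \<psi>))"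
  unfolding dapply_def using assms
  by (intro sum.mono_neutral_left) (auto simp: in_keys_iff)

lemma dapply_zero [simp]: "dapply dx dy 0 \<psi> = 0"
  by (simp add: dapply_def)

lemma dapply_add: "dapply dx dy (P + Q) \<psi> = dapply dx dy P \<psi> + dapply dx dy Q \<psi>"
proof -
  let ?A = "Poly_Mapping.keys P \<union> Poly_Mapping.keys Q"
  have "Poly_Mapping.keys (P + Q) \<subseteq> ?A" by (rule Poly_Mapping.keys_add)
  then show ?thesis
    by (subst (1 2 3) dapply_superset[of ?A])
       (auto simp: lookup_add algebra_simps sum.distrib[symmetric] intro!: sum.cong)
qed

lemma dapply_sum: "dapply dx dy (\<Sum>i\<in>A. P i) \<psi> = (\<Sum>i\<in>A. dapply dx dy (P i) \<psi>)"
  by (induction A rule: infinite_finite_induct) (auto simp: dapply_add)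

text \<open>General Leibniz rule, and from it the fact that \<open>dcomp\<close> is composition of operators.\<close>

lemma derivation_funpow_mult:
  fixes d :: "'k::field_char_0 \<Rightarrow> 'k"
  assumes add: "\<And>u v. d (u + v) = d u + d v" and mult: "\<And>u v. d (u * v) = d u * v + u * d v"
  shows "(d ^^ n) (u * v) = (\<Sum>m\<le>n. of_nat (n choose m) * (d ^^ m) u * (d ^^ (n - m)) v)"
proof (induction n)
  case 0
  then show ?case by simp
next
  case (Suc n)
  have d0: "d 0 = 0" using add[of 0 0] by simp
  have d1: "d 1 = 0" using mult[of 1 1] by simp
  have dnat: "d (of_nat k) = 0" for k by (induction k) (auto simp: d0 d1 add)
  have dsum: "d (\<Sum>i\<in>A. h i) = (\<Sum>i\<in>A. d (h i))" for h :: "nat \<Rightarrow> 'k" and A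
    by (induction A rule: infinite_finite_induct) (auto simp: d0 add)
  let ?t = "\<lambda>i j. (d ^^ i) u * (d ^^ j) v"
  have "(d ^^ Suc n) (u * v) =
      (\<Sum>m\<le>n. of_nat (n choose m) * ?t (Suc m) (n - m)) + (\<Sum>m\<le>n. of_nat (n choose m) * ?t m (Suc (n - m)))"
    by (simp add: Suc dsum mult dnat sum.distrib[symmetric] algebra_simps)
  also have "(\<Sum>m\<le>n. of_nat (n choose m) * ?t m (Suc (n - m)))
      = (\<Sum>m\<le>Suc n. of_nat (n choose m) * ?t m (Suc n - m))"
    by (simp add: Suc_diff_le)
  also have "\<dots> = ?t 0 (Suc n) + (\<Sum>m\<le>n. of_nat (n choose Suc m) * ?t (Suc m) (n - m))"
    by (subst sum.atMost_Suc_shift) simp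
  also have "(\<Sum>m\<le>n. of_nat (n choose m) * ?t (Suc m) (n - m)) + \<dots>
      = ?t 0 (Suc n) + (\<Sum>m\<le>n. of_nat (Suc n choose Suc m) * ?t (Suc m) (n - m))"
    by (simp add: sum.distrib algebra_simps)
  also have "\<dots> = (\<Sum>m\<le>Suc n. of_nat (Suc n choose m) * ?t m (Suc n - m))"
    by (subst sum.atMost_Suc_shift) simp
  finally show ?case by (simp add: mult.assoc)
qed

lemma dapply_dcomp:
  fixes dx dy :: "'k::field_char_0 \<Rightarrow> 'k"
  assumes K: "type_differential_field dx dy"
  shows "dapply dx dy (dcomp dx dy P Q) \<psi> = dapply dx dy P (dapply dx dy Q \<psi>)"
proof -
  have add: "dx (u + v) = dx u + dx v" "dy (u + v) = dy u + dy v"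
    and mult: "dx (u * v) = dx u * v + u * dx v" "dy (u * v) = dy u * v + u * dy v"
    and comm: "dx (dy u) = dy (dx u)" for u v
    using K by (auto simp: type_differential_field_iff)
  have d0: "dx 0 = 0" "dy 0 = 0" using add[of 0 0] by auto
  have padd: "(dx ^^ i) (u + v) = (dx ^^ i) u + (dx ^^ i) v"
    "(dy ^^ i) (u + v) = (dy ^^ i) u + (dy ^^ i) v" for i u v
    by (induction i) (auto simp: add)
  have p0: "(dx ^^ i) 0 = 0" "(dy ^^ i) 0 = 0" for i
    by (induction i) (auto simp: d0)
  have psum: "(dx ^^ i) (\<Sum>a\<in>A. h a) = (\<Sum>a\<in>A. (dx ^^ i) (h a))"
    "(dy ^^ i) (\<Sum>a\<in>A. h a) = (\<Sum>a\<in>A. (dy ^^ i) (h a))" for i h and A :: "'b set"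
    by (induction A rule: infinite_finite_induct) (auto simp: padd p0)
  have dnat: "dx (of_nat n) = 0" for n
  proof -
    have "dx 1 = 0" using mult(1)[of 1 1] by simp
    then show ?thesis by (induction n) (auto simp: d0 add)
  qed
  have pnat: "(dx ^^ i) (of_nat n * u) = of_nat n * (dx ^^ i) u" for i n u
    by (induction i) (auto simp: mult dnat)
  have c1: "dy ((dx ^^ i) u) = (dx ^^ i) (dy u)" for i u
    by (induction i) (auto simp: comm[symmetric])
  have pcomm: "(dy ^^ j) ((dx ^^ i) u) = (dx ^^ i) ((dy ^^ j) u)" for i j u
    by (induction j) (auto simp: c1)
  have mon: "dapply dx dy (dcomp_mon dx dy f i j g k l) \<psi>
      = f * (dx ^^ i) ((dy ^^ j) (g * (dx ^^ k) ((dy ^^ l) \<psi>)))" for f i j g k l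
  proof -
    have "(dx ^^ i) ((dy ^^ j) (g * (dx ^^ k) ((dy ^^ l) \<psi>))) =
      (\<Sum>n\<le>j. \<Sum>m\<le>i. of_nat (j choose n) * (of_nat (i choose m) *
         (dx ^^ m) ((dy ^^ n) g) * (dx ^^ (i - m)) ((dx ^^ k) ((dy ^^ (j - n)) ((dy ^^ l) \<psi>)))))"
      by (simp only: derivation_funpow_mult[OF add(2) mult(2)] psum mult.assoc pnat pcomm)
         (simp only: derivation_funpow_mult[OF add(1) mult(1)] sum_distrib_left mult.assoc pcomm)
    also have "\<dots> = (\<Sum>m\<le>i. \<Sum>n\<le>j. of_nat (j choose n) * (of_nat (i choose m) *
         (dx ^^ m) ((dy ^^ n) g) * (dx ^^ (i - m)) ((dx ^^ k) ((dy ^^ (j - n)) ((dy ^^ l) \<psi>)))))"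
      by (rule sum.swap)
    finally show ?thesis
      by (simp only: dcomp_mon_def dapply_sum dapply_dmon funpow_add o_apply sum_distrib_left mult_ac)
  qed
  show ?thesis
    by (simp add: dcomp_def dapply_sum case_prod_unfold mon)
       (simp add: dapply_def psum sum_distrib_left case_prod_unfold)
qed

end

theory Submission
  imports Defs "HOL-Library.Nat_Bijection"
begin

text \<open>The operator \<open>M\<close> with \<open>q \<noteq> 0\<close> is a Darboux Wronskian formula as soon as \<open>L\<psi> = 0\<close> and
  \<open>M\<psi> = 0\<close> have two common solutions with \<open>d \<noteq> 0\<close>: the equations \<open>M\<psi>\<^sub>1 = M\<psi>\<^sub>2 = 0\<close> are linear
  in \<open>q\<close> and \<open>r\<close>, and Cramer's rule solves them. So the content is that the Darboux relation
  \<open>N \<circ> L = L1 \<circ> M\<close> forces the joint system \<open>L\<psi> = M\<psi> = 0\<close> to have a two-dimensional solution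
  space, that is, to be compatible.

  For a solution \<open>\<psi>\<close>, the equation \<open>M\<psi> = 0\<close> expresses \<open>\<psi>\<^sub>x\<close> through \<open>\<psi>\<close> and \<open>\<psi>\<^sub>y\<close>, and the
  \<open>y\<close>-derivative of \<open>M\<psi> = 0\<close> together with \<open>L\<psi> = 0\<close> gives \<open>\<psi>\<^sub>y\<^sub>y = A \<psi>\<^sub>y + B \<psi>\<close>, as \<open>q\<close> can be
  divided by. For \<open>w = \<psi>\<^sub>y / \<psi>\<close> this means
  \<open>w\<^sub>x = (a r - c) + (a q - b + r) w + q w\<^sup>2\<close> and \<open>w\<^sub>y = B + A w - w\<^sup>2\<close>.
  Comparing coefficients in \<open>N \<circ> L = L1 \<circ> M\<close> (\<open>darboux_coefficient_equations\<close>) and eliminating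
  the coefficients of \<open>N\<close> and \<open>L1\<close> yields the integrability conditions of this pair
  (\<open>riccati_integrable\<close>).

  A compatible pair of Riccati equations has the generic solution \<open>T\<close> in the field \<open>K((T))\<close>
  with suitably extended derivations, hence a solution in the differentially closed field \<open>K\<close>, which
  moreover avoids any prescribed element (\<open>riccati_system_solvable\<close>). This yields
  \<open>w\<^sub>1 \<noteq> w\<^sub>2\<close>. The same lemma, applied to linear equations, recovers nonzero \<open>\<psi>\<^sub>i\<close> from their
  logarithmic derivatives, and \<open>d = \<psi>\<^sub>1 \<psi>\<^sub>2 (w\<^sub>1 - w\<^sub>2) \<noteq> 0\<close>. Solving for \<open>w\<close> before \<open>\<psi>\<close>
  means that only one generic element has to be adjoined at a time.\<close>

section \<open>Riccati systems over differentially closed fields\<close>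

lemma type_differential_field_rules:
  assumes "type_differential_field dx dy"
  shows "dx (u + v) = dx u + dx v" "dy (u + v) = dy u + dy v"
    and "dx (u - v) = dx u - dx v" "dy (u - v) = dy u - dy v"
    and "dx (- u) = - dx u" "dy (- u) = - dy u"
    and "dx (u * v) = dx u * v + u * dx v" "dy (u * v) = dy u * v + u * dy v"
    and "dx 0 = 0" "dy 0 = 0" and "dx 1 = 0" "dy 1 = 0"
    and "dx (dy u) = dy (dx u)"
proof -
  show add: "dx (u + v) = dx u + dx v" "dy (u + v) = dy u + dy v" for u v
    using assms by (simp_all add: type_differential_field_iff)
  show "dx (u * v) = dx u * v + u * dx v" "dy (u * v) = dy u * v + u * dy v" for u v
    using assms by (simp_all add: type_differential_field_iff)
  from this[of 1 1] show "dx 1 = 0" "dy 1 = 0" by simp_all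
  show "dx (dy u) = dy (dx u)" using assms by (simp add: type_differential_field_iff)
  show "dx (u - v) = dx u - dx v" "dy (u - v) = dy u - dy v" for u v
    using add[of "u - v" v] by (simp_all add: algebra_simps)
  from this[of 0 u] this[of 0 0] show "dx 0 = 0" "dy 0 = 0" "dx (- u) = - dx u" "dy (- u) = - dy u"
    by simp_all
qed

text \<open>The definition of differential closedness only offers extensions whose carrier consists of
  functions \<open>nat \<Rightarrow> 'k\<close>. An extension living on a type of its own is brought into this form by
  transporting its structure along any injection \<open>h\<close>; evaluation of differential polynomials
  commutes with \<open>h\<close>, so the solution is transported as well.\<close>

lemma differentially_closedD:
  fixes dx dy :: "'k::field_char_0 \<Rightarrow> 'k" and ex ey :: "'f::field \<Rightarrow> 'f" and \<iota> :: "'k \<Rightarrow> 'f"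
    and h :: "'f \<Rightarrow> nat \<Rightarrow> 'k"
  assumes closed: "differentially_closed dx dy"
    and ext: "differential_extension dx dy ring_of_type_algebra ex ey \<iota>"
    and "inj h" and "finite E" and "finite I"
    and sol: "dsystem_solution ring_of_type_algebra ex ey \<iota> E I v"
  shows "\<exists>w. dsystem_solution ring_of_type_algebra dx dy id E I w"
proof -
  let ?R = "ring_of_type_algebra :: 'f ring"
  let ?h' = "Hilbert_Choice.inv h"
  define F where "F = image_ring h ?R"
  define fx where "fx = h \<circ> ex \<circ> ?h'"
  define fy where "fy = h \<circ> ey \<circ> ?h'"
  have h' [simp]: "?h' (h u) = u" for u using \<open>inj h\<close> by simp
  have Fsimps [simp]: "carrier F = range h" "\<zero>\<^bsub>F\<^esub> = h 0" "\<one>\<^bsub>F\<^esub> = h 1"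
    "h s \<oplus>\<^bsub>F\<^esub> h t = h (s + t)" "h s \<otimes>\<^bsub>F\<^esub> h t = h (s * t)" for s t
    by (simp_all add: F_def image_ring_def image_group_def monoid.defs ring_of_type_algebra_def)
  have fh [simp]: "fx (h u) = h (ex u)" "fy (h u) = h (ey u)" for u
    by (simp_all add: fx_def fy_def)
  have R: "differential_field ?R ex ey" using ext by (simp add: differential_extension_def)
  have "inj_on h (carrier ?R)" using \<open>inj h\<close> by (simp add: inj_on_def)
  then have "field F" unfolding F_def
    using differential_field.axioms(1)[OF R] by (intro field.inj_imp_image_ring_is_field)
  moreover have "differential_field_axioms F fx fy"
    using differential_field.axioms(2)[OF R]
    by (auto simp: differential_field_axioms_def ring_of_type_algebra_def)
  ultimately have "differential_field F fx fy" by (simp add: differential_field_def)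
  then have "differential_extension dx dy F fx fy (h \<circ> \<iota>)"
    using ext by (auto simp: differential_extension_def ring_hom_def ring_of_type_algebra_def)
  moreover have ev: "dpoly_eval F fx fy (h \<circ> \<iota>) (h \<circ> v) p = h (dpoly_eval ?R ex ey \<iota> v p)" for p
    by (induction p) (auto simp: ring_of_type_algebra_def)
  have "dsystem_solution F fx fy (h \<circ> \<iota>) E I (h \<circ> v)"
    using sol \<open>inj h\<close>
    by (auto simp: dsystem_solution_def ev ring_of_type_algebra_def inj_eq)
  ultimately show ?thesis
    using closed \<open>finite E\<close> \<open>finite I\<close> unfolding differentially_closed_def by blast
qed

definition fls_map :: "('a::zero \<Rightarrow> 'b::zero) \<Rightarrow> 'a fls \<Rightarrow> 'b fls" where
  "fls_map d f = Abs_fls (\<lambda>n. d (fls_nth f n))"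

lemma fls_map_nth [simp]: "d 0 = 0 \<Longrightarrow> fls_nth (fls_map d f) n = d (fls_nth f n)"
  unfolding fls_map_def
  by (rule nth_Abs_fls_lower_bound[where N = "fls_subdegree f"]) auto

text \<open>The Cauchy product formula with arbitrary lower bounds in place of the subdegrees. The
  subdegree may rise when a derivation is applied to the coefficients, so a common lower bound is
  what makes the Leibniz rule below a computation with one index range.\<close>

lemma fls_times_nth_lower_bounds:
  fixes f g :: "'a::semiring_0 fls"
  assumes f: "\<And>k. k < m \<Longrightarrow> fls_nth f k = 0" and g: "\<And>k. k < n \<Longrightarrow> fls_nth g k = 0"
  shows "fls_nth (f * g) k = (\<Sum>i = m..k - n. fls_nth f i * fls_nth g (k - i))"
proof (cases "f = 0 \<or> g = 0")
  case True
  then show ?thesis by auto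
next
  case False
  then have "m \<le> fls_subdegree f" "n \<le> fls_subdegree g"
    using assms by (auto intro!: fls_subdegree_geI)
  then have "(\<Sum>i = fls_subdegree f..k - fls_subdegree g. fls_nth f i * fls_nth g (k - i))
      = (\<Sum>i = m..k - n. fls_nth f i * fls_nth g (k - i))"
    by (intro sum.mono_neutral_left) auto
  then show ?thesis by (simp add: fls_times_nth(2))
qed

lemma fls_map_mult:
  fixes d :: "'a::comm_ring_1 \<Rightarrow> 'a"
  assumes add: "\<And>u v. d (u + v) = d u + d v" and mult: "\<And>u v. d (u * v) = d u * v + u * d v"
  shows "fls_map d (f * g) = fls_map d f * g + f * fls_map d g"
proof (rule fls_eqI)
  fix k
  have d0: "d 0 = 0" using add[of 0 0] by simp
  have dsum: "d (sum u A) = (\<Sum>i\<in>A. d (u i))" for u and A :: "int set"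
    by (induction A rule: infinite_finite_induct) (auto simp: d0 add)
  let ?m = "fls_subdegree f" and ?n = "fls_subdegree g"
  have bounds: "\<And>i. i < ?m \<Longrightarrow> fls_nth f i = 0" "\<And>i. i < ?n \<Longrightarrow> fls_nth g i = 0"
    "\<And>i. i < ?m \<Longrightarrow> fls_nth (fls_map d f) i = 0" "\<And>i. i < ?n \<Longrightarrow> fls_nth (fls_map d g) i = 0"
    by (simp_all add: d0)
  show "fls_nth (fls_map d (f * g)) k = fls_nth (fls_map d f * g + f * fls_map d g) k"
    by (simp add: d0 fls_times_nth_lower_bounds[of ?m _ ?n] bounds dsum mult sum.distrib)
qed

lemma inj_fls_coefficients:
  "inj (\<lambda>(f :: 'a::zero fls) n. fls_nth f (int_decode n))"
  by (intro injI fls_eqI) (metis int_encode_inverse)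

text \<open>Two prescriptions \<open>w\<^sub>x = P(w)\<close>, \<open>w\<^sub>y = Q(w)\<close> with polynomials \<open>P\<close>, \<open>Q\<close> are compatible if
  \<open>P(T)\<close> and \<open>Q(T)\<close> satisfy \<open>Q\<^sup>x + P Q' = P\<^sup>y + Q P'\<close>, where \<open>Q\<^sup>x\<close> differentiates the
  coefficients; the three hypotheses are this identity for quadratic polynomials, coefficient by
  coefficient (the cubic terms agree automatically). Under it the field of Laurent series \<open>K((T))\<close>
  carries the commuting derivations \<open>f \<mapsto> f\<^sup>x + P f'\<close> and \<open>f \<mapsto> f\<^sup>y + Q f'\<close>, for
  which the transcendental element \<open>T\<close> is a solution. Differential closedness brings a solution down
  to \<open>K\<close>; as \<open>T\<close> differs from every element of \<open>K\<close>, a prescribed value \<open>s\<close> can be avoided.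

  Laurent series are a convenient extension because the two derivations are given by closed formulas
  on coefficients, with no fractions to be differentiated.\<close>

lemma riccati_system_solvable:
  fixes dx dy :: "'k::field_char_0 \<Rightarrow> 'k"
  assumes closed: "differentially_closed dx dy"
    and int0: "dx q0 + p0 * q1 = dy p0 + q0 * p1"
    and int1: "dx q1 + 2 * p0 * q2 = dy p1 + 2 * q0 * p2"
    and int2: "dx q2 + p1 * q2 = dy p2 + q1 * p2"
  shows "\<exists>w. dx w = p0 + p1 * w + p2 * w ^ 2 \<and> dy w = q0 + q1 * w + q2 * w ^ 2 \<and> w \<noteq> s"
proof -
  have K: "type_differential_field dx dy" using closed by (simp add: differentially_closed_def)
  note rules = type_differential_field_rules[OF K]
  have dnat: "dx (of_nat n) = 0" "dy (of_nat n) = 0" for n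
    by (induction n) (auto simp: rules)
  have dint: "dx (of_int n) = 0" "dy (of_int n) = 0" for n
    by (cases n rule: int_cases2; simp add: rules dnat)+
  define C where "C = (fls_const :: 'k \<Rightarrow> 'k fls)"
  have C: "C (u + v) = C u + C v" "C (u * v) = C u * C v" "C 1 = 1" "C 0 = 0" "C (- u) = - C u"
    "fls_deriv (C u) = 0" for u v
    unfolding C_def
    by (rule fls_plus_const[symmetric] fls_const_mult_const[symmetric] fls_const_1 fls_const_0
          fls_const_uminus fls_deriv_const)+
  define T where "T = (fls_X :: 'k fls)"
  define P where "P = C p0 + C p1 * T + C p2 * T ^ 2"
  define Q where "Q = C q0 + C q1 * T + C q2 * T ^ 2"
  define ex where "ex f = fls_map dx f + P * fls_deriv f" for f
  define ey where "ey f = fls_map dy f + Q * fls_deriv f" for f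
  have madd: "fls_map dx (f + g) = fls_map dx f + fls_map dx g"
      "fls_map dy (f + g) = fls_map dy f + fls_map dy g" for f g
    by (auto intro!: fls_eqI simp: rules)
  have mmult: "fls_map dx (f * g) = fls_map dx f * g + f * fls_map dx g"
      "fls_map dy (f * g) = fls_map dy f * g + f * fls_map dy g" for f g
    by (rule fls_map_mult; rule rules)+
  have mC: "fls_map dx (C u) = C (dx u)" "fls_map dy (C u) = C (dy u)" for u
    by (auto intro!: fls_eqI simp: rules C_def)
  have mT: "fls_map dx T = 0" "fls_map dy T = 0"
    by (auto intro!: fls_eqI simp: rules T_def)
  have mderiv: "fls_map dx (fls_deriv f) = fls_deriv (fls_map dx f)"
    "fls_map dy (fls_deriv f) = fls_deriv (fls_map dy f)" for f
    by (auto intro!: fls_eqI simp: rules dint algebra_simps)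
  have mcomm: "fls_map dx (fls_map dy f) = fls_map dy (fls_map dx f)" for f
    by (auto intro!: fls_eqI simp: rules)
  have dT: "fls_deriv T = 1" by (simp add: T_def)
  have "C (dx q0 + p0 * q1) = C (dy p0 + q0 * p1)"
    "C (dx q1 + 2 * p0 * q2) = C (dy p1 + 2 * q0 * p2)"
    "C (dx q2 + p1 * q2) = C (dy p2 + q1 * p2)"
    by (simp_all only: int0 int1 int2)
  moreover have "C 2 = 2" using C(1)[of 1 1] C(3) by simp
  ultimately have "ex Q = ey P"
    unfolding ex_def ey_def P_def Q_def madd mmult mC mT fls_deriv_add fls_deriv_mult C dT
      power2_eq_square
    by Groebner_Basis.algebra
  \<comment> \<open>The commutator of \<open>ex\<close> and \<open>ey\<close> is \<open>ex Q - ey P\<close> times the derivative by \<open>T\<close>.\<close>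
  then have PQ: "fls_map dx Q + P * fls_deriv Q = fls_map dy P + Q * fls_deriv P"
    by (simp add: ex_def ey_def)
  have "ex (ey f) = ey (ex f)" for f
    unfolding ex_def ey_def madd mmult mderiv mcomm fls_deriv_add fls_deriv_mult
    using PQ by Groebner_Basis.algebra
  then have "differential_field ring_of_type_algebra ex ey"
    unfolding differential_field_def differential_field_axioms_def
    using field_from_type_algebra
    by (auto simp: ring_of_type_algebra_def ex_def ey_def madd mmult algebra_simps)
  then have ext: "differential_extension dx dy ring_of_type_algebra ex ey C"
    by (auto simp: differential_extension_def ring_hom_def ring_of_type_algebra_def C ex_def ey_def mC)
  define poly where "poly k0 k1 k2 = Plus (Coef k0) (Plus (Times (Coef k1) (Indet 0))
      (Times (Coef k2) (Times (Indet 0) (Indet 0))))" for k0 k1 k2 :: 'k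
  define minus where "minus p q = Plus p (Times (Coef (- 1)) q)" for p q :: "'k dpoly"
  let ?E = "{minus (DerivX (Indet 0)) (poly p0 p1 p2), minus (DerivY (Indet 0)) (poly q0 q1 q2)}"
  let ?I = "{minus (Indet 0) (Coef s)}"
  have "T \<noteq> C s"
    using dT C(6)[of s] by auto
  then have "dsystem_solution ring_of_type_algebra ex ey C ?E ?I (\<lambda>_. T)"
    by (simp add: dsystem_solution_def ring_of_type_algebra_def minus_def poly_def ex_def ey_def
        mT dT P_def Q_def C power2_eq_square algebra_simps)
  then have "\<exists>w. dsystem_solution ring_of_type_algebra dx dy id ?E ?I w"
    by (intro differentially_closedD[OF closed ext inj_fls_coefficients]) simp_all
  then obtain w where "dsystem_solution ring_of_type_algebra dx dy id ?E ?I w" ..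
  then have "dx (w 0) = p0 + p1 * w 0 + p2 * w 0 ^ 2 \<and> dy (w 0) = q0 + q1 * w 0 + q2 * w 0 ^ 2
      \<and> w 0 \<noteq> s"
    by (simp add: dsystem_solution_def ring_of_type_algebra_def minus_def poly_def
        power2_eq_square algebra_simps)
  then show ?thesis ..
qed

text \<open>Linear equations are the degenerate Riccati equations; avoiding the value \<open>0\<close> excludes the trivial
  solution.\<close>

corollary log_derivatives_solvable:
  fixes dx dy :: "'k::field_char_0 \<Rightarrow> 'k"
  assumes closed: "differentially_closed dx dy" and "dx v = dy u"
  shows "\<exists>\<psi>. \<psi> \<noteq> 0 \<and> dx \<psi> = u * \<psi> \<and> dy \<psi> = v * \<psi>"
proof -
  have "type_differential_field dx dy" using closed by (simp add: differentially_closed_def)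
  note rules = type_differential_field_rules[OF this]
  have "\<exists>\<psi>. dx \<psi> = 0 + u * \<psi> + 0 * \<psi> ^ 2 \<and> dy \<psi> = 0 + v * \<psi> + 0 * \<psi> ^ 2 \<and> \<psi> \<noteq> 0"
    by (rule riccati_system_solvable[OF closed]) (simp_all add: rules assms(2))
  then show ?thesis by auto
qed

section \<open>Coefficients of composed differential operators\<close>

lemma dmon_add: "dmon (f + g) i j = dmon f i j + dmon g i j"
  by (simp add: dmon_def single_add)

lemma dmon_zero [simp]: "dmon 0 i j = 0"
  by (simp add: dmon_def)

lemma lookup_dmon: "Poly_Mapping.lookup (dmon f i j) x = (if x = (i, j) then f else 0)"
  by (simp add: dmon_def lookup_single when_def)

lemma dcomp_mon_add_left:
  "dcomp_mon dx dy (f + f') i j g k l = dcomp_mon dx dy f i j g k l + dcomp_mon dx dy f' i j g k l"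
  by (simp add: dcomp_mon_def distrib_right dmon_add sum.distrib)

lemma dcomp_mon_zero_left [simp]: "dcomp_mon dx dy 0 i j g k l = 0"
  by (simp add: dcomp_mon_def)

lemma funpow_additive:
  fixes d :: "'k::ab_group_add \<Rightarrow> 'k"
  assumes "\<And>u v. d (u + v) = d u + d v"
  shows "(d ^^ n) (u + v) = (d ^^ n) u + (d ^^ n) v" and "(d ^^ n) 0 = 0"
proof -
  have "d 0 = 0" using assms[of 0 0] by simp
  then show "(d ^^ n) 0 = 0" by (induction n) auto
  show "(d ^^ n) (u + v) = (d ^^ n) u + (d ^^ n) v" by (induction n) (auto simp: assms)
qed

lemma
  fixes dx dy :: "'k::field_char_0 \<Rightarrow> 'k"
  assumes "type_differential_field dx dy"
  shows dcomp_mon_add_right: "dcomp_mon dx dy f i j (g + g') k l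
      = dcomp_mon dx dy f i j g k l + dcomp_mon dx dy f i j g' k l"
    and dcomp_mon_zero_right: "dcomp_mon dx dy f i j 0 k l = 0"
proof -
  note rules = type_differential_field_rules[OF assms]
  note pow = funpow_additive[of dx, OF rules(1)] funpow_additive[of dy, OF rules(2)]
  show "dcomp_mon dx dy f i j (g + g') k l
      = dcomp_mon dx dy f i j g k l + dcomp_mon dx dy f i j g' k l"
    by (simp add: dcomp_mon_def pow distrib_left dmon_add sum.distrib)
  show "dcomp_mon dx dy f i j 0 k l = 0"
    by (simp add: dcomp_mon_def pow)
qed

text \<open>The support of a sum of operators may be smaller than the union of their supports. Enlarging the
  index sets makes the bilinearity of composition a statement about sums over fixed sets.\<close>

lemma dcomp_superset:
  fixes dx dy :: "'k::field_char_0 \<Rightarrow> 'k"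
  assumes K: "type_differential_field dx dy"
    and "finite A" "Poly_Mapping.keys P \<subseteq> A" "finite B" "Poly_Mapping.keys Q \<subseteq> B"
  shows "dcomp dx dy P Q = (\<Sum>(i, j)\<in>A. \<Sum>(k, l)\<in>B.
      dcomp_mon dx dy (Poly_Mapping.lookup P (i, j)) i j (Poly_Mapping.lookup Q (k, l)) k l)"
proof -
  have "(\<Sum>(k, l)\<in>Poly_Mapping.keys Q. dcomp_mon dx dy f i j (Poly_Mapping.lookup Q (k, l)) k l)
      = (\<Sum>(k, l)\<in>B. dcomp_mon dx dy f i j (Poly_Mapping.lookup Q (k, l)) k l)" for f i j
    using assms(4,5) by (intro sum.mono_neutral_left) (auto simp: in_keys_iff dcomp_mon_zero_right[OF K])
  then show ?thesis
    unfolding dcomp_def using assms(2,3)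
    by (simp, intro sum.mono_neutral_left) (auto simp: in_keys_iff)
qed

lemma
  fixes dx dy :: "'k::field_char_0 \<Rightarrow> 'k"
  assumes K: "type_differential_field dx dy"
  shows dcomp_add_left: "dcomp dx dy (P + P') Q = dcomp dx dy P Q + dcomp dx dy P' Q"
    and dcomp_add_right: "dcomp dx dy P (Q + Q') = dcomp dx dy P Q + dcomp dx dy P Q'"
    and dcomp_dmon: "dcomp dx dy (dmon f i j) (dmon g k l) = dcomp_mon dx dy f i j g k l"
proof -
  let ?A = "Poly_Mapping.keys P \<union> Poly_Mapping.keys P'"
  have "Poly_Mapping.keys (P + P') \<subseteq> ?A" by (rule Poly_Mapping.keys_add)
  then show "dcomp dx dy (P + P') Q = dcomp dx dy P Q + dcomp dx dy P' Q"
    by (subst (1 2 3) dcomp_superset[OF K, of ?A _ "Poly_Mapping.keys Q"])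
       (auto simp: lookup_add dcomp_mon_add_left sum.distrib case_prod_unfold)
  let ?B = "Poly_Mapping.keys Q \<union> Poly_Mapping.keys Q'"
  have "Poly_Mapping.keys (Q + Q') \<subseteq> ?B" by (rule Poly_Mapping.keys_add)
  then show "dcomp dx dy P (Q + Q') = dcomp dx dy P Q + dcomp dx dy P Q'"
    by (subst (1 2 3) dcomp_superset[OF K, of "Poly_Mapping.keys P" _ ?B])
       (auto simp: lookup_add dcomp_mon_add_right[OF K] sum.distrib case_prod_unfold)
  show "dcomp dx dy (dmon f i j) (dmon g k l) = dcomp_mon dx dy f i j g k l"
    by (subst dcomp_superset[OF K, of "{(i, j)}" _ "{(k, l)}"]) (auto simp: dmon_def)
qed

lemma le_dorder: "Poly_Mapping.lookup P (i, j) \<noteq> 0 \<Longrightarrow> i + j \<le> dorder P"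
  unfolding dorder_def by (intro Max_ge) (auto simp: in_keys_iff intro!: image_eqI[of _ _ "(i, j)"])

lemma dorder_le: "(\<And>i j. Poly_Mapping.lookup P (i, j) \<noteq> 0 \<Longrightarrow> i + j \<le> n) \<Longrightarrow> dorder P \<le> n"
  unfolding dorder_def by (subst Max_le_iff) (auto simp: in_keys_iff)

lemma dorder_attained:
  assumes "dorder P > 0"
  obtains i j where "Poly_Mapping.lookup P (i, j) \<noteq> 0" and "i + j = dorder P"
proof -
  have "dorder P \<in> insert 0 ((\<lambda>(i, j). i + j) ` Poly_Mapping.keys P)"
    unfolding dorder_def by (rule Max_in) auto
  with assms that show thesis by (auto simp: in_keys_iff)
qed

lemma lookup_dsymbol:
  "Poly_Mapping.lookup (dsymbol P) (i, j) = (if i + j = dorder P then Poly_Mapping.lookup P (i, j) else 0)"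
proof -
  let ?S = "{(i, j). (i, j) \<in> Poly_Mapping.keys P \<and> i + j = dorder P}"
  have "finite ?S" by (rule finite_subset[OF _ finite_keys[of P]]) auto
  moreover have "Poly_Mapping.lookup (dsymbol P) (i, j)
      = (\<Sum>x\<in>?S. if x = (i, j) then Poly_Mapping.lookup P (i, j) else 0)"
    unfolding dsymbol_def lookup_sum
    by (intro sum.cong) (auto simp: lookup_single when_def)
  ultimately show ?thesis by (auto simp: in_keys_iff)
qed

text \<open>Terms of the Leibniz formula in which a coefficient is differentiated have smaller order, so in
  top order composition is multiplication of polynomials.\<close>

lemma lookup_dcomp_mon_top:
  assumes "i + j + k + l \<le> s + t"
  shows "Poly_Mapping.lookup (dcomp_mon dx dy f i j g k l) (s, t)
    = (if (i + k, j + l) = (s, t) then f * g else 0)"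
proof -
  have "Poly_Mapping.lookup (dcomp_mon dx dy f i j g k l) (s, t)
    = (\<Sum>m\<le>i. \<Sum>n\<le>j. if m = 0 \<and> n = 0 \<and> (i + k, j + l) = (s, t) then f * g else 0)"
    unfolding dcomp_mon_def lookup_sum lookup_dmon
    using assms by (intro sum.cong refl) auto
  also have "\<dots> = (\<Sum>m\<le>i. if m = 0 then (\<Sum>n\<le>j. if n = 0 then
      (if (i + k, j + l) = (s, t) then f * g else 0) else 0) else 0)"
    by (intro sum.cong refl) auto
  finally show ?thesis by simp
qed

lemma lookup_dcomp_top:
  fixes dx dy :: "'k::field_char_0 \<Rightarrow> 'k"
  assumes "dorder P + dorder Q \<le> s + t"
  shows "Poly_Mapping.lookup (dcomp dx dy P Q) (s, t)
    = (\<Sum>(i, j)\<in>Poly_Mapping.keys P. \<Sum>(k, l)\<in>Poly_Mapping.keys Q.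
        if (i + k, j + l) = (s, t) then Poly_Mapping.lookup P (i, j) * Poly_Mapping.lookup Q (k, l) else 0)"
proof -
  have "i + j + k + l \<le> s + t" if "(i, j) \<in> Poly_Mapping.keys P" "(k, l) \<in> Poly_Mapping.keys Q"
    for i j k l using that le_dorder[of P i j] le_dorder[of Q k l] assms by (simp add: in_keys_iff)
  then show ?thesis
    unfolding dcomp_def lookup_sum case_prod_unfold
    by (intro sum.cong refl, subst lookup_dcomp_mon_top) auto
qed

lemma lookup_dcomp_above_order:
  fixes dx dy :: "'k::field_char_0 \<Rightarrow> 'k"
  assumes "dorder P + dorder Q < s + t"
  shows "Poly_Mapping.lookup (dcomp dx dy P Q) (s, t) = 0"
proof -
  have "(if (fst x + fst y, snd x + snd y) = (s, t)
      then Poly_Mapping.lookup P (fst x, snd x) * Poly_Mapping.lookup Q (fst y, snd y) else 0) = 0"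
    if "x \<in> Poly_Mapping.keys P" "y \<in> Poly_Mapping.keys Q" for x y
    using that le_dorder[of P "fst x" "snd x"] le_dorder[of Q "fst y" "snd y"] assms
    by (auto simp: in_keys_iff)
  then show ?thesis
    using assms unfolding case_prod_unfold
    by (subst lookup_dcomp_top) (auto simp only: case_prod_unfold less_imp_le intro!: sum.neutral ballI)
qed

lemma order1_eq:
  assumes "dorder P \<le> 1"
  obtains u v w where "P = dmon u 1 0 + dmon v 0 1 + dmon w 0 0"
proof
  show "P = dmon (Poly_Mapping.lookup P (1, 0)) 1 0 + dmon (Poly_Mapping.lookup P (0, 1)) 0 1
    + dmon (Poly_Mapping.lookup P (0, 0)) 0 0"
  proof (rule poly_mapping_eqI)
    fix x :: "nat \<times> nat"
    obtain i j where x: "x = (i, j)" by force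
    consider "x = (0, 0)" | "x = (1, 0)" | "x = (0, 1)" | "i + j > 1" unfolding x by fastforce
    then show "Poly_Mapping.lookup P x = Poly_Mapping.lookup (dmon (Poly_Mapping.lookup P (1, 0)) 1 0
      + dmon (Poly_Mapping.lookup P (0, 1)) 0 1 + dmon (Poly_Mapping.lookup P (0, 0)) 0 0) x"
      using le_dorder[of P i j] assms by cases (auto simp: lookup_add lookup_dmon x)
  qed
qed

lemma
  assumes "L = dmon 1 1 1 + dmon a 1 0 + dmon b 0 1 + dmon c 0 0"
  shows dorder_hyperbolic: "dorder L = 2" and dsymbol_hyperbolic: "dsymbol L = dmon 1 1 1"
proof -
  have L: "Poly_Mapping.lookup L (i, j) = (if (i, j) = (1, 1) then 1 else if (i, j) = (1, 0) then a
      else if (i, j) = (0, 1) then b else if (i, j) = (0, 0) then c else 0)" for i j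
    by (simp add: assms lookup_add lookup_dmon)
  show o: "dorder L = 2"
  proof (rule antisym)
    show "dorder L \<le> 2" by (rule dorder_le) (auto simp: L split: if_splits)
    show "2 \<le> dorder L" using le_dorder[of L 1 1] by (simp add: L)
  qed
  show "dsymbol L = dmon 1 1 1"
    by (rule poly_mapping_eqI) (auto simp: lookup_dsymbol o L lookup_dmon split: if_splits)
qed

lemma symbol_hyperbolicE:
  assumes "dsymbol P = dmon 1 1 1"
  obtains a b c where "P = dmon 1 1 1 + dmon a 1 0 + dmon b 0 1 + dmon c 0 0"
proof
  have s: "(if i + j = dorder P then Poly_Mapping.lookup P (i, j) else 0) = (if (i, j) = (1, 1) then 1 else 0)"
    for i j using lookup_dsymbol[of P i j] by (simp add: assms lookup_dmon)
  from s[of 1 1] have o: "dorder P = 2" and P11: "Poly_Mapping.lookup P (1, 1) = 1"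
    by (auto split: if_splits)
  show "P = dmon 1 1 1 + dmon (Poly_Mapping.lookup P (1, 0)) 1 0
    + dmon (Poly_Mapping.lookup P (0, 1)) 0 1 + dmon (Poly_Mapping.lookup P (0, 0)) 0 0"
  proof (rule poly_mapping_eqI)
    fix x :: "nat \<times> nat"
    obtain i j where x: "x = (i, j)" by force
    consider "x = (0, 0)" | "x = (1, 0)" | "x = (0, 1)" | "x = (1, 1)" | "i + j > 2"
      | "i + j = 2" "x \<noteq> (1, 1)"
      unfolding x by fastforce
    then show "Poly_Mapping.lookup P x = Poly_Mapping.lookup (dmon 1 1 1
      + dmon (Poly_Mapping.lookup P (1, 0)) 1 0 + dmon (Poly_Mapping.lookup P (0, 1)) 0 1
      + dmon (Poly_Mapping.lookup P (0, 0)) 0 0) x"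
      using le_dorder[of P i j] s[of i j] P11 o
      by cases (auto simp: lookup_add lookup_dmon x split: if_splits)
  qed
qed

text \<open>Since \<open>D\<^sub>xD\<^sub>y\<close> is the only term of second order in \<open>L\<close>, composing with \<open>L\<close> merely shifts the
  top order coefficients of \<open>N\<close>; in particular they cannot cancel.\<close>

lemma lookup_dcomp_hyperbolic_top:
  fixes dx dy :: "'k::field_char_0 \<Rightarrow> 'k"
  assumes L: "L = dmon 1 1 1 + dmon a 1 0 + dmon b 0 1 + dmon c 0 0"
    and ij: "i0 + j0 = dorder N"
  shows "Poly_Mapping.lookup (dcomp dx dy N L) (i0 + 1, j0 + 1) = Poly_Mapping.lookup N (i0, j0)"
proof -
  let ?s = "i0 + 1" and ?t = "j0 + 1"
  have keysL: "(k, l) = (1, 1) \<or> k + l < 2" if "(k, l) \<in> Poly_Mapping.keys L" for k l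
    using that by (auto simp: in_keys_iff L lookup_add lookup_dmon split: if_splits)
  have L11: "Poly_Mapping.lookup L (1, 1) = 1" by (simp add: L lookup_add lookup_dmon)
  have summand: "(if (fst x + fst y, snd x + snd y) = (?s, ?t)
        then Poly_Mapping.lookup N (fst x, snd x) * Poly_Mapping.lookup L (fst y, snd y) else 0)
      = (if y = (1, 1) then if x = (i0, j0) then Poly_Mapping.lookup N x else 0 else 0)"
    if "x \<in> Poly_Mapping.keys N" "y \<in> Poly_Mapping.keys L" for x y
  proof (cases "y = (1, 1)")
    case True
    then show ?thesis using L11 by (cases x) auto
  next
    case False
    then have "fst x + snd x + (fst y + snd y) < ?s + ?t"
      using that keysL[of "fst y" "snd y"] le_dorder[of N "fst x" "snd x"] ij
      by (auto simp: in_keys_iff)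
    then show ?thesis using False by auto
  qed
  have "Poly_Mapping.lookup (dcomp dx dy N L) (?s, ?t)
    = (\<Sum>(i, j)\<in>Poly_Mapping.keys N. \<Sum>(k, l)\<in>Poly_Mapping.keys L.
        if (i + k, j + l) = (?s, ?t) then Poly_Mapping.lookup N (i, j) * Poly_Mapping.lookup L (k, l) else 0)"
    using ij by (intro lookup_dcomp_top) (simp add: dorder_hyperbolic[OF L])
  also have "\<dots> = (\<Sum>x\<in>Poly_Mapping.keys N. \<Sum>y\<in>Poly_Mapping.keys L.
        if y = (1, 1) then if x = (i0, j0) then Poly_Mapping.lookup N x else 0 else 0)"
    unfolding case_prod_unfold by (intro sum.cong refl summand)
  also have "\<dots> = Poly_Mapping.lookup N (i0, j0)"
    using L11 by (simp add: in_keys_iff)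
  finally show ?thesis .
qed

text \<open>Since \<open>L1\<close> has the symbol of \<open>L\<close>, the product \<open>L1 \<circ> M\<close> has order at most \<open>3\<close>, while the
  order of \<open>N \<circ> L\<close> exceeds that of \<open>N\<close> by \<open>2\<close>. So \<open>N\<close> has order at most \<open>1\<close>, and the
  intertwining relation becomes finitely many equations between coefficients. Those of third order
  and of \<open>D\<^sub>x\<^sup>2\<close> determine the leading coefficients \<open>1\<close>, \<open>q\<close> of \<open>N\<close> and show that
  \<open>L\<close> and \<open>L1\<close> share the coefficient \<open>a\<close>.\<close>

lemma darboux_coefficient_equations:
  fixes dx dy :: "'k::field_char_0 \<Rightarrow> 'k"
  assumes K: "type_differential_field dx dy"
    and L: "L = dmon 1 1 1 + dmon a 1 0 + dmon b 0 1 + dmon c 0 0"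
    and M: "M = dmon 1 1 0 + dmon q 0 1 + dmon r 0 0"
    and D: "darboux_transformation dx dy L M N L1"
  obtains n0 b1 c1 where
    "b + q * a + n0 = dy q + r + a * q + b1"
    "q * b = dx q + b1 * q"
    "dx a + c + q * dy a + n0 * a = dy r + a * r + c1"
    "dx b + q * dy b + q * c + n0 * b
          = dx (dy q) + dx r + a * dx q + b1 * dy q + b1 * r + c1 * q"
    "dx c + q * dy c + n0 * c = dx (dy r) + a * dx r + b1 * dy r + c1 * r"
proof -
  note rules = type_differential_field_rules[OF K]
  have comp: "dcomp dx dy N L = dcomp dx dy L1 M" and "dsymbol L1 = dmon 1 1 1"
    using D dsymbol_hyperbolic[OF L] by (auto simp: darboux_transformation_def)
  from this(2) obtain a1 b1 c1 where L1: "L1 = dmon 1 1 1 + dmon a1 1 0 + dmon b1 0 1 + dmon c1 0 0"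
    by (rule symbol_hyperbolicE)
  have oM: "dorder M \<le> 1"
    by (rule dorder_le) (auto simp: M lookup_add lookup_dmon split: if_splits)
  have "dorder N \<le> 1"
  proof (rule ccontr)
    assume "\<not> dorder N \<le> 1"
    then have "dorder N > 0" by simp
    then obtain i0 j0 where N0: "Poly_Mapping.lookup N (i0, j0) \<noteq> 0" and ij: "i0 + j0 = dorder N"
      by (rule dorder_attained)
    have "Poly_Mapping.lookup (dcomp dx dy N L) (i0 + 1, j0 + 1) = Poly_Mapping.lookup N (i0, j0)"
      by (rule lookup_dcomp_hyperbolic_top[OF L ij])
    then have "Poly_Mapping.lookup (dcomp dx dy N L) (i0 + 1, j0 + 1) \<noteq> 0" using N0 by simp
    moreover have "Poly_Mapping.lookup (dcomp dx dy L1 M) (i0 + 1, j0 + 1) = 0"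
      using oM dorder_hyperbolic[OF L1] ij \<open>\<not> dorder N \<le> 1\<close>
      by (intro lookup_dcomp_above_order) simp
    ultimately show False by (simp add: comp)
  qed
  then obtain n1 n2 n0 where N: "N = dmon n1 1 0 + dmon n2 0 1 + dmon n0 0 0"
    by (rule order1_eq)
  have co: "Poly_Mapping.lookup (dcomp dx dy N L) x = Poly_Mapping.lookup (dcomp dx dy L1 M) x" for x
    by (simp add: comp)
  note expand = L M N L1 dcomp_add_left[OF K] dcomp_add_right[OF K] dcomp_dmon[OF K] dcomp_mon_def
    lookup_add lookup_dmon rules(9-12)
  from co[of "(2, 1)"] have n1: "n1 = 1" by (simp add: expand)
  from co[of "(1, 2)"] have n2: "n2 = q" by (simp add: expand)
  from co[of "(2, 0)"] have a1: "a1 = a" by (simp add: expand n1)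
  show thesis
  proof (rule that)
    show "b + q * a + n0 = dy q + r + a * q + b1"
      using co[of "(1, 1)"] by (simp add: expand n1 n2 a1 algebra_simps)
    show "q * b = dx q + b1 * q"
      using co[of "(0, 2)"] by (simp add: expand n1 n2 a1 algebra_simps)
    show "dx a + c + q * dy a + n0 * a = dy r + a * r + c1"
      using co[of "(1, 0)"] by (simp add: expand n1 n2 a1 algebra_simps)
    show "dx b + q * dy b + q * c + n0 * b
          = dx (dy q) + dx r + a * dx q + b1 * dy q + b1 * r + c1 * q"
      using co[of "(0, 1)"] by (simp add: expand n1 n2 a1 algebra_simps)
    show "dx c + q * dy c + n0 * c = dx (dy r) + a * dx r + b1 * dy r + c1 * r"
      using co[of "(0, 0)"] by (simp add: expand n1 n2 a1 algebra_simps)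
  qed
qed

section \<open>Common solutions of the two operators\<close>

text \<open>If \<open>\<psi>\<close> is annihilated by both operators, then eliminating \<open>\<psi>\<^sub>x\<close> and \<open>\<psi>\<^sub>x\<^sub>y\<close> gives
  \<open>\<psi>\<^sub>y\<^sub>y = A \<psi>\<^sub>y + B \<psi>\<close>, with \<open>A\<close> and \<open>B\<close> as below, and \<open>w = \<psi>\<^sub>y / \<psi>\<close> satisfies a pair of Riccati
  equations. The two conclusions are the parts of the
  compatibility of that pair that do not already follow from the choice of \<open>A\<close> and \<open>B\<close>. The hypotheses
  are the coefficients of \<open>D\<^sub>xD\<^sub>y\<close>, \<open>D\<^sub>y\<^sup>2\<close>, \<open>D\<^sub>x\<close>, \<open>D\<^sub>y\<close>, \<open>1\<close> in the intertwining relation; eliminating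
  the unknown coefficients \<open>n0\<close>, \<open>b1\<close>, \<open>c1\<close> from them leaves these two conditions.\<close>

lemma riccati_integrable:
  fixes dx dy :: "'k::field_char_0 \<Rightarrow> 'k"
  assumes K: "type_differential_field dx dy" and "q \<noteq> 0"
    and XY: "b + q * a + n0 = dy q + r + a * q + b1"
    and YY: "q * b = dx q + b1 * q"
    and X: "dx a + c + q * dy a + n0 * a = dy r + a * r + c1"
    and Y: "dx b + q * dy b + q * c + n0 * b
          = dx (dy q) + dx r + a * dx q + b1 * dy q + b1 * r + c1 * q"
    and Z: "dx c + q * dy c + n0 * c = dx (dy r) + a * dx r + b1 * dy r + c1 * r"
    and A: "q * A = b - a * q - dy q - r" and B: "q * B = c - a * r - dy r"
  shows "dx A = dy (a * q - b - r)"
    and "dx B + (a * r - c) * A = dy (a * r - c) + B * (a * q - b + r)"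
proof -
  note rules = type_differential_field_rules[OF K]
  \<comment> \<open>\<open>k\<close> is the logarithmic derivative \<open>q\<^sub>x / q\<close>: naming it keeps the elimination polynomial,
    so that \<open>q\<close> is cancelled only once, at the end.\<close>
  define k where "k = b - b1"
  have qx: "dx q = k * q" using YY by (simp add: k_def algebra_simps)
  have b1: "b1 = b - k" by (simp add: k_def)
  have n0: "n0 = dy q + r - k" using XY by (simp add: k_def algebra_simps)
  have c1: "c1 = dx a + c + q * dy a + n0 * a - dy r - a * r" using X by (simp add: algebra_simps)
  have "dx (q * A) = dx (b - a * q - dy q - r)" by (simp only: A)
  then have Ax: "k * (q * A) + q * dx A = dx b - dx a * q - a * dx q - dx (dy q) - dx r"
    unfolding rules qx by Groebner_Basis.algebra
  have "q * dx A = q * dy (a * q - b - r)"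
    using Ax Y unfolding rules A qx c1 n0 b1 by Groebner_Basis.algebra
  then show "dx A = dy (a * q - b - r)" using \<open>q \<noteq> 0\<close> by simp
  have "dx (q * B) = dx (c - a * r - dy r)" by (simp only: B)
  then have Bx: "k * (q * B) + q * dx B = dx c - dx a * r - a * dx r - dx (dy r)"
    unfolding rules qx by Groebner_Basis.algebra
  have "q * dx B = dx c - dx a * r - a * dx r - dx (dy r) - k * (c - a * r - dy r)"
    using Bx unfolding B by Groebner_Basis.algebra
  moreover have "q * (a * r - c) * A = (a * r - c) * (b - a * q - dy q - r)"
    unfolding A[symmetric] by Groebner_Basis.algebra
  moreover have "q * B * (a * q - b + r) = (c - a * r - dy r) * (a * q - b + r)"
    unfolding B ..
  ultimately have "q * (dx B + (a * r - c) * A) = q * (dy (a * r - c) + B * (a * q - b + r))"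
    using Z unfolding rules c1 n0 b1 by Groebner_Basis.algebra
  then show "dx B + (a * r - c) * A = dy (a * r - c) + B * (a * q - b + r)"
    using \<open>q \<noteq> 0\<close> by simp
qed

text \<open>A solution \<open>w\<close> of the Riccati pair is the logarithmic \<open>y\<close>-derivative of a common solution
  \<open>\<psi>\<close> of \<open>M\<psi> = 0\<close> and \<open>L\<psi> = 0\<close>; the equation \<open>M\<psi> = 0\<close> dictates its logarithmic
  \<open>x\<close>-derivative \<open>- (q w + r)\<close>. The freedom to avoid \<open>s\<close> serves to produce a second,
  independent solution.\<close>

lemma common_solution_exists:
  fixes dx dy :: "'k::field_char_0 \<Rightarrow> 'k"
  assumes closed: "differentially_closed dx dy"
    and A: "q * A = b - a * q - dy q - r" and B: "q * B = c - a * r - dy r"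
    and int_A: "dx A = dy (a * q - b - r)"
    and int_B: "dx B + (a * r - c) * A = dy (a * r - c) + B * (a * q - b + r)"
  shows "\<exists>w \<psi>. w \<noteq> s \<and> \<psi> \<noteq> 0 \<and> dy \<psi> = w * \<psi> \<and> dx \<psi> = - (q * w + r) * \<psi> \<and>
    dx (dy \<psi>) + a * dx \<psi> + b * dy \<psi> + c * \<psi> = 0"
proof -
  have K: "type_differential_field dx dy" using closed by (simp add: differentially_closed_def)
  note rules = type_differential_field_rules[OF K]
  have "\<exists>w. dx w = (a * r - c) + (a * q - b + r) * w + q * w ^ 2 \<and> dy w = B + A * w + (- 1) * w ^ 2 \<and> w \<noteq> s"
  proof (rule riccati_system_solvable[OF closed])
    show "dx B + (a * r - c) * A = dy (a * r - c) + B * (a * q - b + r)" by (fact int_B)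
    show "dx A + 2 * (a * r - c) * (- 1) = dy (a * q - b + r) + 2 * B * q"
      using int_A B unfolding rules by Groebner_Basis.algebra
    show "dx (- 1) + (a * q - b + r) * (- 1) = dy q + A * q"
      using A unfolding rules by Groebner_Basis.algebra
  qed
  then obtain w where wx: "dx w = (a * r - c) + (a * q - b + r) * w + q * w ^ 2"
    and wy: "dy w = B + A * w + (- 1) * w ^ 2" and "w \<noteq> s" by blast
  have "dx w = dy (- (q * w + r))"
    using A B unfolding rules wx wy by Groebner_Basis.algebra
  then obtain \<psi> where "\<psi> \<noteq> 0" and \<psi>x: "dx \<psi> = - (q * w + r) * \<psi>" and \<psi>y: "dy \<psi> = w * \<psi>"
    using log_derivatives_solvable[OF closed] by blast
  have "dx (dy \<psi>) + a * dx \<psi> + b * dy \<psi> + c * \<psi> = 0"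
    unfolding \<psi>y rules \<psi>x wx by Groebner_Basis.algebra
  with \<open>w \<noteq> s\<close> \<open>\<psi> \<noteq> 0\<close> \<psi>x \<psi>y show ?thesis by blast
qed

lemma lin_indep2_if_wronskian_nonzero:
  fixes dx dy :: "'k::field_char_0 \<Rightarrow> 'k"
  assumes K: "type_differential_field dx dy" and d: "- \<psi>1 * dy \<psi>2 + \<psi>2 * dy \<psi>1 \<noteq> 0"
  shows "lin_indep2 dx dy \<psi>1 \<psi>2"
  unfolding lin_indep2_def
proof (intro ballI impI)
  fix c1 c2
  assume c: "c1 \<in> constants dx dy" "c2 \<in> constants dx dy" and rel: "c1 * \<psi>1 + c2 * \<psi>2 = 0"
  note rules = type_differential_field_rules[OF K]
  have "dy (c1 * \<psi>1 + c2 * \<psi>2) = 0" by (simp only: rel rules)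
  then have rel': "c1 * dy \<psi>1 + c2 * dy \<psi>2 = 0" using c by (simp add: constants_def rules)
  have "c1 * (- \<psi>1 * dy \<psi>2 + \<psi>2 * dy \<psi>1) = 0" "c2 * (- \<psi>1 * dy \<psi>2 + \<psi>2 * dy \<psi>1) = 0"
    using rel rel' by Groebner_Basis.algebra+
  with d show "c1 = 0 \<and> c2 = 0" by simp
qed

theorem theorem7p5:
  fixes dx dy :: "'k::field_char_0 \<Rightarrow> 'k"
    and a b c q r :: 'k
    and L M N L1 :: "'k diffop"
  assumes "type_differential_field dx dy"
    and "differentially_closed dx dy"
    and "L = dmon 1 1 1 + dmon a 1 0 + dmon b 0 1 + dmon c 0 0"
    and "M = dmon 1 1 0 + dmon q 0 1 + dmon r 0 0"
    and "q \<noteq> 0"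
    and "darboux_transformation dx dy L M N L1"
  shows "\<exists>\<psi>1 \<psi>2.
    dapply dx dy L \<psi>1 = 0 \<and> dapply dx dy L \<psi>2 = 0 \<and> lin_indep2 dx dy \<psi>1 \<psi>2 \<and>
    (let d = - \<psi>1 * dy \<psi>2 + \<psi>2 * dy \<psi>1;
         \<alpha> = \<psi>1 * dx \<psi>2 - \<psi>2 * dx \<psi>1;
         \<beta> = - dx \<psi>2 * dy \<psi>1 + dy \<psi>2 * dx \<psi>1
     in d \<noteq> 0 \<and> M = dmon 1 1 0 + dmon (\<alpha> / d) 0 1 + dmon (\<beta> / d) 0 0)"
proof -
  note K = assms(1) and closed = assms(2) and L = assms(3) and M = assms(4)
  note rules = type_differential_field_rules[OF K]
  define A where "A = (b - a * q - dy q - r) / q"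
  define B where "B = (c - a * r - dy r) / q"
  have A: "q * A = b - a * q - dy q - r" and B: "q * B = c - a * r - dy r"
    using \<open>q \<noteq> 0\<close> by (simp_all add: A_def B_def)
  obtain n0 b1 c1 where
    eqs: "b + q * a + n0 = dy q + r + a * q + b1" "q * b = dx q + b1 * q"
    "dx a + c + q * dy a + n0 * a = dy r + a * r + c1"
    "dx b + q * dy b + q * c + n0 * b = dx (dy q) + dx r + a * dx q + b1 * dy q + b1 * r + c1 * q"
    "dx c + q * dy c + n0 * c = dx (dy r) + a * dx r + b1 * dy r + c1 * r"
    by (rule darboux_coefficient_equations[OF K L M assms(6)])
  note solution = common_solution_exists[OF closed A B
      riccati_integrable[OF K \<open>q \<noteq> 0\<close> eqs A B]]
  obtain w1 \<psi>1 where \<psi>1: "\<psi>1 \<noteq> 0" "dy \<psi>1 = w1 * \<psi>1" "dx \<psi>1 = - (q * w1 + r) * \<psi>1"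
    and L1: "dx (dy \<psi>1) + a * dx \<psi>1 + b * dy \<psi>1 + c * \<psi>1 = 0"
    using solution[of 0] by blast
  obtain w2 \<psi>2 where \<psi>2: "\<psi>2 \<noteq> 0" "dy \<psi>2 = w2 * \<psi>2" "dx \<psi>2 = - (q * w2 + r) * \<psi>2"
    and L2: "dx (dy \<psi>2) + a * dx \<psi>2 + b * dy \<psi>2 + c * \<psi>2 = 0" and "w2 \<noteq> w1"
    using solution[of w1] by blast
  define d where "d = - \<psi>1 * dy \<psi>2 + \<psi>2 * dy \<psi>1"
  have "d = \<psi>1 * \<psi>2 * (w1 - w2)" by (simp add: d_def \<psi>1 \<psi>2 algebra_simps)
  then have "d \<noteq> 0" using \<psi>1(1) \<psi>2(1) \<open>w2 \<noteq> w1\<close> by simp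
  have "\<psi>1 * dx \<psi>2 - \<psi>2 * dx \<psi>1 = q * d" "- dx \<psi>2 * dy \<psi>1 + dy \<psi>2 * dx \<psi>1 = r * d"
    unfolding d_def \<psi>1(2,3) \<psi>2(2,3) by Groebner_Basis.algebra+
  then have "(\<psi>1 * dx \<psi>2 - \<psi>2 * dx \<psi>1) / d = q" "(- dx \<psi>2 * dy \<psi>1 + dy \<psi>2 * dx \<psi>1) / d = r"
    using \<open>d \<noteq> 0\<close> by simp_all
  then have "M = dmon 1 1 0 + dmon ((\<psi>1 * dx \<psi>2 - \<psi>2 * dx \<psi>1) / d) 0 1
      + dmon ((- dx \<psi>2 * dy \<psi>1 + dy \<psi>2 * dx \<psi>1) / d) 0 0"
    by (simp only: M)
  moreover have "lin_indep2 dx dy \<psi>1 \<psi>2"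
    using lin_indep2_if_wronskian_nonzero[OF K] \<open>d \<noteq> 0\<close> by (simp add: d_def)
  moreover have "dapply dx dy L \<psi>1 = 0" "dapply dx dy L \<psi>2 = 0"
    using L1 L2 by (simp_all add: L dapply_add)
  ultimately show ?thesis
    using \<open>d \<noteq> 0\<close> unfolding d_def Let_def by blast
qed

end
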